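(* Let $e$ be an element of a simple connected binary matroid $M$. Then at least one of the following holds: (i) $M$ is a circuit; (ii) $M$ has a hyperplane $H$ with $e\in H$ such that $M|H$ is connected; (iii) $M$ has a series class of size at least three that does not contain $e$.
   Context: A series class of a matroid is an equivalence class of the relation on non-coloop elements in which $x\sim y$ if $x=y$ or $\{x,y\}$ is a cocircuit.
   Formalization: The formal theorem also assumes that M has at least two elements; this excludes only the one-element matroid consisting of a single coloop e, which is simple, connected and binary but satisfies none of (i), (ii), (iii). *)

theory Defs
  imports Main "HOL-Library.Z2"
begin

record 'a indep_system =
  ground :: "'a set"
  indep :: "'a set \<Rightarrow> bool"

definition matroid :: "'a indep_system \<Rightarrow> bool" where
  "matroid M \<longleftrightarrow>
     finite (ground M) \<and>
     (\<forall>X. indep M X \<longrightarrow> X \<subseteq> ground M) \<and>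
     indep M {} \<and>
     (\<forall>X Y. indep M X \<and> Y \<subseteq> X \<longrightarrow> indep M Y) \<and>
     (\<forall>X Y. indep M X \<and> indep M Y \<and> card X < card Y \<longrightarrow>
        (\<exists>y\<in>Y - X. indep M (insert y X)))"

definition basis :: "'a indep_system \<Rightarrow> 'a set \<Rightarrow> bool" where
  "basis M B \<longleftrightarrow> indep M B \<and> (\<forall>X. indep M X \<and> B \<subseteq> X \<longrightarrow> X = B)"

definition circuit :: "'a indep_system \<Rightarrow> 'a set \<Rightarrow> bool" where
  "circuit M C \<longleftrightarrow> C \<subseteq> ground M \<and> \<not> indep M C \<and> (\<forall>X. X \<subset> C \<longrightarrow> indep M X)"

definition loop :: "'a indep_system \<Rightarrow> 'a \<Rightarrow> bool" where
  "loop M x \<longleftrightarrow> circuit M {x}"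

definition dual :: "'a indep_system \<Rightarrow> 'a indep_system" where
  "dual M = \<lparr>ground = ground M,
             indep = (\<lambda>X. \<exists>B. basis M B \<and> X \<subseteq> ground M - B)\<rparr>"

definition cocircuit :: "'a indep_system \<Rightarrow> 'a set \<Rightarrow> bool" where
  "cocircuit M C \<longleftrightarrow> circuit (dual M) C"

definition coloop :: "'a indep_system \<Rightarrow> 'a \<Rightarrow> bool" where
  "coloop M x \<longleftrightarrow> loop (dual M) x"

definition restriction :: "'a indep_system \<Rightarrow> 'a set \<Rightarrow> 'a indep_system" where
  "restriction M S = \<lparr>ground = S, indep = (\<lambda>X. X \<subseteq> S \<and> indep M X)\<rparr>"

definition rank :: "'a indep_system \<Rightarrow> 'a set \<Rightarrow> nat" where
  "rank M S = Max (card ` {X. X \<subseteq> S \<and> indep M X})"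

definition matroid_closure :: "'a indep_system \<Rightarrow> 'a set \<Rightarrow> 'a set" where
  "matroid_closure M S = {x \<in> ground M. rank M (insert x S) = rank M S}"

definition flat :: "'a indep_system \<Rightarrow> 'a set \<Rightarrow> bool" where
  "flat M F \<longleftrightarrow> F \<subseteq> ground M \<and> matroid_closure M F = F"

definition hyperplane :: "'a indep_system \<Rightarrow> 'a set \<Rightarrow> bool" where
  "hyperplane M H \<longleftrightarrow> flat M H \<and> rank M H + 1 = rank M (ground M)"

definition simple_matroid :: "'a indep_system \<Rightarrow> bool" where
  "simple_matroid M \<longleftrightarrow>
     (\<forall>x\<in>ground M. \<not> loop M x) \<and>
     (\<forall>x\<in>ground M. \<forall>y\<in>ground M. x \<noteq> y \<longrightarrow> \<not> circuit M {x, y})"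

definition connected_matroid :: "'a indep_system \<Rightarrow> bool" where
  "connected_matroid M \<longleftrightarrow>
     (\<forall>x\<in>ground M. \<forall>y\<in>ground M. x \<noteq> y \<longrightarrow> (\<exists>C. circuit M C \<and> x \<in> C \<and> y \<in> C))"

text \<open>
  Linear independence over the two-element field of the family of columns of \<open>A\<close> indexed by \<open>X\<close>,
  where \<open>A\<close> has rows \<open>0, \<dots>, m - 1\<close>; it concerns the family, not the set of columns, so
  repeated columns are dependent.
\<close>

definition columns_independent :: "nat \<Rightarrow> (nat \<Rightarrow> 'a \<Rightarrow> bit) \<Rightarrow> 'a set \<Rightarrow> bool" where
  "columns_independent m A X \<longleftrightarrow>
     (\<forall>c :: 'a \<Rightarrow> bit. (\<forall>i<m. (\<Sum>x\<in>X. c x * A i x) = 0) \<longrightarrow> (\<forall>x\<in>X. c x = 0))"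

definition binary_matroid :: "'a indep_system \<Rightarrow> bool" where
  "binary_matroid M \<longleftrightarrow>
     (\<exists>m A. \<forall>X. X \<subseteq> ground M \<longrightarrow> (indep M X \<longleftrightarrow> columns_independent m A X))"

definition series_relation :: "'a indep_system \<Rightarrow> ('a \<times> 'a) set" where
  "series_relation M =
     {(x, y). x \<in> ground M \<and> \<not> coloop M x \<and> y \<in> ground M \<and> \<not> coloop M y \<and>
              (x = y \<or> cocircuit M {x, y})}"

definition series_class :: "'a indep_system \<Rightarrow> 'a set \<Rightarrow> bool" where
  "series_class M S \<longleftrightarrow> S \<in> {x \<in> ground M. \<not> coloop M x} // series_relation M"

end

theory Submission
  imports Defs
begin

text \<open>Among the sets \<open>S\<close> containing \<open>e\<close> with \<open>M|S\<close> connected and \<open>r(S) < r(M)\<close>, let \<open>F\<close> be a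
  maximal one. Such an \<open>F\<close> is a flat, so if \<open>r(F) = r(M) - 1\<close> it is the desired hyperplane.
  Otherwise choose a circuit \<open>C\<close> that meets \<open>F\<close>, is not contained in \<open>F\<close> and has \<open>|C - F|\<close>
  minimal. Then \<open>C - F\<close> is a circuit of \<open>M/F\<close> and, by maximality of \<open>F\<close>, \<open>F \<union> C\<close> spans \<open>M\<close>, so
  \<open>|C - F| = r(M) - r(F) + 1 \<ge> 3\<close>. An element \<open>z\<close> outside \<open>F \<union> C\<close> lies on a circuit \<open>Z\<close> inside
  \<open>F \<union> C \<union> {z}\<close>, and on a circuit inside the symmetric difference of \<open>Z\<close> and \<open>C\<close>; these two use
  disjoint parts of \<open>C - F\<close>, and one that meets \<open>F\<close> uses all but one element of \<open>C - F\<close>. Hence they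
  do not both meet \<open>F\<close>; if just one does, the other has at most two elements, against simplicity;
  if neither does, their symmetric difference is a cycle properly contained in \<open>C\<close>. So
  \<open>M\<close> has ground set \<open>F \<union> C\<close>, every circuit contains or avoids \<open>C - F\<close>, and \<open>C - F\<close> lies in a
  series class. That class avoids \<open>e\<close> unless \<open>F = {e}\<close>, in which case \<open>M\<close> is the circuit \<open>C\<close>.\<close>

section \<open>Rank and circuits\<close>

locale finite_matroid =
  fixes M :: "'a indep_system"
  assumes matroid: "matroid M"
begin

lemma finite_ground: "finite (ground M)"
  and indep_subset_ground: "indep M X \<Longrightarrow> X \<subseteq> ground M"
  and indep_empty: "indep M {}"
  and indep_subset: "indep M X \<Longrightarrow> Y \<subseteq> X \<Longrightarrow> indep M Y"
  and augment: "indep M X \<Longrightarrow> indep M Y \<Longrightarrow> card X < card Y \<Longrightarrow> \<exists>y\<in>Y - X. indep M (insert y X)"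
  using matroid unfolding matroid_def by metis+

lemma finite_indep_subsets: "finite {X. X \<subseteq> S \<and> indep M X}"
  by (rule finite_subset[of _ "Pow (ground M)"]) (auto simp: finite_ground dest: indep_subset_ground)

lemma finite_indep: "indep M X \<Longrightarrow> finite X"
  using finite_ground finite_subset indep_subset_ground by blast

lemma card_le_rank: "X \<subseteq> S \<Longrightarrow> indep M X \<Longrightarrow> card X \<le> rank M S"
  unfolding rank_def by (rule Max_ge) (use finite_indep_subsets in auto)

lemma obtain_rank:
  obtains I where "I \<subseteq> S" "indep M I" "card I = rank M S"
proof -
  have "rank M S \<in> card ` {X. X \<subseteq> S \<and> indep M X}"
    unfolding rank_def by (rule Max_in) (use finite_indep_subsets indep_empty in auto)
  then show ?thesis using that by auto
qed

lemma extend_indep: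
  assumes "X \<subseteq> S" "indep M X"
  obtains I where "X \<subseteq> I" "I \<subseteq> S" "indep M I" "card I = rank M S"
proof -
  let ?P = "\<lambda>I. X \<subseteq> I \<and> I \<subseteq> S \<and> indep M I"
  have "?P X" using assms by auto
  moreover have "\<forall>I. ?P I \<longrightarrow> card I \<le> rank M S" using card_le_rank by auto
  \<comment> \<open>\<open>ex_has_greatest_nat\<close> expects a strict bound, hence the
    \<open>Suc\<close>.\<close>
  then have "\<forall>I. ?P I \<longrightarrow> card I < Suc (rank M S)" by (simp add: less_Suc_eq_le)
  ultimately obtain I where I: "?P I" and max: "\<And>J. ?P J \<Longrightarrow> card J \<le> card I"
    using ex_has_greatest_nat[of ?P X card "Suc (rank M S)"] by metis
  obtain J where J: "J \<subseteq> S" "indep M J" "card J = rank M S" by (rule obtain_rank)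
  have "card I = rank M S"
  proof (rule ccontr)
    assume "card I \<noteq> rank M S"
    then have "card I < card J" using card_le_rank[of I S] I J by linarith
    then obtain y where y: "y \<in> J - I" "indep M (insert y I)" using augment[of I J] I J by auto
    then have "card (insert y I) \<le> card I" using I J by (intro max) auto
    then show False using y finite_indep I by auto
  qed
  then show ?thesis using I that by auto
qed

lemma rank_mono: "S \<subseteq> T \<Longrightarrow> rank M S \<le> rank M T"
  by (metis obtain_rank card_le_rank subset_trans)

lemma rank_Un_le:
  assumes "finite T"
  shows "rank M (S \<union> T) \<le> rank M S + card (T - S)"
proof -
  obtain J where J: "J \<subseteq> S \<union> T" "indep M J" "card J = rank M (S \<union> T)" by (rule obtain_rank)
  have "card J = card (J \<inter> S) + card (J - S)"
    using finite_indep[OF J(2)] by (metis card_Int_Diff)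
  also have "card (J \<inter> S) \<le> rank M S" using J indep_subset by (intro card_le_rank) auto
  also have "card (J - S) \<le> card (T - S)" using J assms by (intro card_mono) auto
  finally show ?thesis using J by simp
qed

lemma circuit_dependent: "circuit M C \<Longrightarrow> C \<subseteq> X \<Longrightarrow> \<not> indep M X"
  using indep_subset unfolding circuit_def by metis

lemma circuit_subset_ground: "circuit M C \<Longrightarrow> C \<subseteq> ground M"
  unfolding circuit_def by simp

lemma finite_circuit: "circuit M C \<Longrightarrow> finite C"
  using circuit_subset_ground finite_ground finite_subset by metis

lemma circuit_remove_indep: "circuit M C \<Longrightarrow> c \<in> C \<Longrightarrow> indep M (C - {c})"
  unfolding circuit_def by auto

text \<open>A largest independent subset of \<open>S\<close> extending \<open>C - {c}\<close> stays
  largest in \<open>insert c S\<close>: adding \<open>c\<close> would complete \<open>C\<close>, and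
  adding an element of \<open>S\<close> would exceed the rank of \<open>S\<close>.\<close>

lemma rank_insert_circuit:
  assumes "circuit M C" "c \<in> C" "C \<subseteq> insert c S"
  shows "rank M (insert c S) = rank M S"
proof (cases "c \<in> S")
  case False
  have "indep M (C - {c})" "C - {c} \<subseteq> S" using assms circuit_remove_indep by auto
  then obtain I where I: "C - {c} \<subseteq> I" "I \<subseteq> S" "indep M I" "card I = rank M S"
    using extend_indep by blast
  obtain J where J: "J \<subseteq> insert c S" "indep M J" "card J = rank M (insert c S)" by (rule obtain_rank)
  have "\<not> card I < card J"
  proof
    assume "card I < card J"
    then obtain y where y: "y \<in> J - I" "indep M (insert y I)" using augment[of I J] I J by auto
    show False
    proof (cases "y = c")
      case True
      then have "C \<subseteq> insert y I" using I by auto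
      then show False using y circuit_dependent[OF assms(1)] by simp
    next
      case False
      then have "card (insert y I) \<le> card I" using I y J card_le_rank[of "insert y I" S] by auto
      then show False using y finite_indep[OF I(3)] by auto
    qed
  qed
  moreover have "rank M S \<le> rank M (insert c S)" by (rule rank_mono) auto
  ultimately show ?thesis using I J by simp
qed (simp add: insert_absorb)

text \<open>One element of \<open>C\<close> outside \<open>S\<close> is spanned by \<open>S\<close>
  and the rest of \<open>C\<close>; each of the others raises the rank by at most one.\<close>

lemma rank_Un_circuit:
  assumes "circuit M C" "\<not> C \<subseteq> S"
  shows "rank M (S \<union> C) + 1 \<le> rank M S + card (C - S)"
proof -
  obtain c where c: "c \<in> C" "c \<notin> S" using assms by auto
  have fin: "finite C" using assms finite_circuit by simp
  have "S \<union> C = insert c (S \<union> (C - {c}))" using c by auto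
  then have "rank M (S \<union> C) = rank M (S \<union> (C - {c}))"
    using rank_insert_circuit[OF assms(1) c(1), of "S \<union> (C - {c})"] by auto
  also have "\<dots> \<le> rank M S + card (C - {c} - S)" using fin by (intro rank_Un_le) auto
  also have "C - {c} - S = (C - S) - {c}" by auto
  finally have "rank M (S \<union> C) \<le> rank M S + card (C - S - {c})" .
  moreover have "card (C - S) = Suc (card (C - S - {c}))" using c fin by (intro card.remove) auto
  ultimately show ?thesis by simp
qed

lemma obtain_circuit:
  assumes "X \<subseteq> ground M" "\<not> indep M X"
  obtains C where "circuit M C" "C \<subseteq> X"
proof -
  have "\<exists>C. circuit M C \<and> C \<subseteq> X" if "finite X" "X \<subseteq> ground M" "\<not> indep M X" for X
    using that
  proof (induction X rule: finite_psubset_induct)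
    case (psubset X)
    show ?case
    proof (cases "circuit M X")
      case False
      then obtain Y where Y: "Y \<subset> X" "\<not> indep M Y" using psubset.prems unfolding circuit_def by auto
      then have "\<exists>C. circuit M C \<and> C \<subseteq> Y" using psubset.IH psubset.prems by auto
      then show ?thesis using Y by auto
    qed auto
  qed
  from this[OF finite_subset[OF assms(1) finite_ground] assms] show ?thesis using that by auto
qed

lemma obtain_circuit_insert:
  assumes "S \<subseteq> ground M" "x \<in> ground M" "rank M (insert x S) = rank M S" "x \<notin> S"
  obtains C where "circuit M C" "x \<in> C" "C \<subseteq> insert x S"
proof -
  obtain I where I: "I \<subseteq> S" "indep M I" "card I = rank M S" by (rule obtain_rank)
  have "\<not> indep M (insert x I)"
  proof
    assume "indep M (insert x I)"
    then have "card (insert x I) \<le> card I" using card_le_rank[of "insert x I" "insert x S"] I assms by auto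
    moreover have "x \<notin> I" using I assms by auto
    ultimately show False using finite_indep[OF I(2)] by simp
  qed
  then obtain C where C: "circuit M C" "C \<subseteq> insert x I"
    using obtain_circuit[of "insert x I"] I assms by blast
  then have "x \<in> C" using I(2) circuit_dependent[OF C(1), of I] by auto
  then show ?thesis using that C I by blast
qed

lemma basis_iff: "basis M B \<longleftrightarrow> indep M B \<and> card B = rank M (ground M)"
proof (intro iffI conjI)
  assume B: "basis M B"
  then show "indep M B" unfolding basis_def by auto
  then show "card B = rank M (ground M)"
    using B extend_indep[of B "ground M"] indep_subset_ground unfolding basis_def by metis
next
  assume B: "indep M B \<and> card B = rank M (ground M)"
  have "X = B" if "indep M X" "B \<subseteq> X" for X
    using that B card_le_rank[of X "ground M"] indep_subset_ground finite_indep card_seteq by metis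
  then show "basis M B" using B unfolding basis_def by auto
qed

lemma simple_pair_indep:
  assumes "simple_matroid M" "x \<in> ground M" "y \<in> ground M"
  shows "indep M {x, y}"
proof (rule ccontr)
  assume "\<not> indep M {x, y}"
  then obtain C where C: "circuit M C" "C \<subseteq> {x, y}" using obtain_circuit[of "{x, y}"] assms by auto
  moreover have "C \<noteq> {}" using circuit_dependent[OF C(1), of "{}"] indep_empty by auto
  ultimately have "C = {x} \<or> C = {y} \<or> C = {x, y}" by auto
  then show False using C assms unfolding simple_matroid_def loop_def by (cases "x = y") auto
qed

lemma circuit_restriction: "circuit (restriction M S) C \<longleftrightarrow> C \<subseteq> S \<and> circuit M C" if "S \<subseteq> ground M"
  using that unfolding circuit_def restriction_def by auto

section \<open>Coloops and two-element cocircuits\<close>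

lemma obtain_basis_avoiding:
  assumes "circuit M K" "x \<in> K"
  obtains B where "basis M B" "K - {x} \<subseteq> B" "x \<notin> B"
proof -
  have "indep M (K - {x})" "K - {x} \<subseteq> ground M"
    using assms circuit_remove_indep circuit_subset_ground by auto
  then obtain B where B: "K - {x} \<subseteq> B" "indep M B" "card B = rank M (ground M)"
    using extend_indep by metis
  moreover have "x \<notin> B"
  proof
    assume "x \<in> B"
    then have "K \<subseteq> B" using B by auto
    then show False using B circuit_dependent assms by simp
  qed
  ultimately show ?thesis using that basis_iff by blast
qed

lemma dual_indep_singleton:
  assumes "connected_matroid M" "2 \<le> card (ground M)" "x \<in> ground M"
  shows "indep (dual M) {x}"
proof -
  have "\<not> ground M \<subseteq> {x}" using assms(2) card_mono[of "{x}" "ground M"] by auto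
  then obtain y where "y \<in> ground M" "x \<noteq> y" by auto
  then obtain K where "circuit M K" "x \<in> K" using assms unfolding connected_matroid_def by blast
  then obtain B where "basis M B" "x \<notin> B" by (rule obtain_basis_avoiding)
  then show ?thesis using assms unfolding dual_def by auto
qed

lemma not_coloop:
  assumes "connected_matroid M" "2 \<le> card (ground M)" "x \<in> ground M"
  shows "\<not> coloop M x"
  using dual_indep_singleton[OF assms] unfolding coloop_def loop_def circuit_def by auto

text \<open>Singletons are independent in the dual, so minimality of a dependent pair is
  automatic.\<close>

lemma cocircuit_pair_iff:
  assumes "connected_matroid M" "2 \<le> card (ground M)" "x \<in> ground M" "y \<in> ground M"
  shows "cocircuit M {x, y} \<longleftrightarrow> \<not> indep (dual M) {x, y}"
proof -
  have x: "indep (dual M) {x}" and y: "indep (dual M) {y}"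
    using assms dual_indep_singleton by blast+
  have "indep (dual M) X" if "X \<subset> {x, y}" for X
  proof -
    have "X \<subseteq> {x} \<or> X \<subseteq> {y}" using that by auto
    then show ?thesis using x y unfolding dual_def by auto
  qed
  then show ?thesis using assms unfolding cocircuit_def circuit_def by (auto simp: dual_def)
qed

text \<open>A circuit and a cocircuit never share exactly one element. Concretely,
  \<open>K - {e}\<close> extends to a basis avoiding \<open>x\<close>, since \<open>x\<close> is not
  a coloop, and this basis cannot contain \<open>e\<close> without containing
  \<open>K\<close>.\<close>

lemma not_cocircuit_pair:
  assumes "connected_matroid M" "2 \<le> card (ground M)"
    and K: "circuit M K" "e \<in> K" "x \<notin> K" "x \<in> ground M"
  shows "\<not> cocircuit M {x, e}"
proof -
  obtain B where B: "basis M B" "x \<notin> B"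
    using dual_indep_singleton[OF assms(1,2) K(4)] unfolding dual_def by auto
  have "indep M (K - {e})" "K - {e} \<subseteq> ground M - {x}"
    using K circuit_remove_indep circuit_subset_ground by auto
  then obtain I where I: "K - {e} \<subseteq> I" "I \<subseteq> ground M - {x}" "indep M I" "card I = rank M (ground M - {x})"
    using extend_indep by metis
  have "card B \<le> rank M (ground M - {x})"
    using B basis_iff indep_subset_ground by (intro card_le_rank) auto
  then have "card I = rank M (ground M)"
    using I B basis_iff rank_mono[of "ground M - {x}" "ground M"] by auto
  then have "basis M I" using I basis_iff by auto
  moreover have "e \<notin> I"
  proof
    assume "e \<in> I"
    then have "K \<subseteq> I" using I by auto
    then show False using I K circuit_dependent by simp
  qed
  moreover have eg: "e \<in> ground M" using K unfolding circuit_def by auto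
  ultimately have "indep (dual M) {x, e}" using I K unfolding dual_def by auto
  then show ?thesis using cocircuit_pair_iff assms eg by blast
qed

end

section \<open>Cycle space and circuits of a binary matroid\<close>

text \<open>\<open>cyc\<close> stands for the cycle space: the sets of columns that sum to zero over the
  two-element field.\<close>

locale binary_cycles = finite_matroid +
  fixes cyc :: "'a set \<Rightarrow> bool"
  assumes cyc_sym_diff: "cyc X \<Longrightarrow> cyc Y \<Longrightarrow> X \<subseteq> ground M \<Longrightarrow> Y \<subseteq> ground M \<Longrightarrow> cyc (sym_diff X Y)"
    and indep_iff_cyc: "X \<subseteq> ground M \<Longrightarrow> indep M X \<longleftrightarrow> (\<forall>Z\<subseteq>X. cyc Z \<longrightarrow> Z = {})"
begin

lemma circuit_iff_cyc:
  "circuit M C \<longleftrightarrow> C \<subseteq> ground M \<and> C \<noteq> {} \<and> cyc C \<and> (\<forall>Z\<subseteq>C. cyc Z \<longrightarrow> Z = {} \<or> Z = C)"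
proof
  assume C: "circuit M C"
  then have g: "C \<subseteq> ground M" unfolding circuit_def by auto
  then obtain Z where Z: "Z \<subseteq> C" "cyc Z" "Z \<noteq> {}"
    using C indep_iff_cyc[OF g] unfolding circuit_def by auto
  have *: "X = {} \<or> X = C" if "X \<subseteq> C" "cyc X" for X
    using that C g indep_iff_cyc[of X] unfolding circuit_def by auto
  then have "Z = C" using Z by auto
  then show "C \<subseteq> ground M \<and> C \<noteq> {} \<and> cyc C \<and> (\<forall>Z\<subseteq>C. cyc Z \<longrightarrow> Z = {} \<or> Z = C)"
    using * Z g by auto
next
  assume C: "C \<subseteq> ground M \<and> C \<noteq> {} \<and> cyc C \<and> (\<forall>Z\<subseteq>C. cyc Z \<longrightarrow> Z = {} \<or> Z = C)"
  then have "indep M X" if "X \<subset> C" for X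
    using that indep_iff_cyc[of X] by blast
  then show "circuit M C" using C indep_iff_cyc[of C] unfolding circuit_def by blast
qed

text \<open>If a cycle properly contains a nonempty cycle \<open>D\<close>, then its complement of
  \<open>D\<close> is a cycle too; induction continues in whichever of the two contains
  \<open>x\<close>.\<close>

lemma obtain_circuit_cyc:
  assumes "cyc Z" "Z \<subseteq> ground M" "x \<in> Z"
  obtains C where "circuit M C" "x \<in> C" "C \<subseteq> Z"
proof -
  have "finite Z" using assms finite_ground finite_subset by blast
  then have "\<exists>C. circuit M C \<and> x \<in> C \<and> C \<subseteq> Z" using assms
  proof (induction Z rule: finite_psubset_induct)
    case (psubset Z)
    show ?case
    proof (cases "circuit M Z")
      case False
      then obtain D where D: "D \<subset> Z" "cyc D" "D \<noteq> {}"
        using circuit_iff_cyc[of Z] psubset.prems by blast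
      have "sym_diff Z D = Z - D" using D by auto
      then have "cyc (Z - D)" using cyc_sym_diff[of Z D] D psubset.prems by auto
      moreover have "Z - D \<subset> Z" using D by auto
      ultimately show ?thesis using psubset.IH[of D] psubset.IH[of "Z - D"] D psubset.prems
        by (cases "x \<in> D") blast+
    qed (use psubset.prems in auto)
  qed
  then show ?thesis using that by blast
qed

text \<open>The symmetric difference of the two circuits contains disjoint circuits through \<open>x\<close> and \<open>z\<close>;
  if neither contains both elements, the one through \<open>z\<close> can replace \<open>C2\<close>, with a smaller union.\<close>

lemma circuit_trans:
  assumes "circuit M C1" "circuit M C2" "x \<in> C1" "z \<in> C2" "C1 \<inter> C2 \<noteq> {}"
  shows "\<exists>D. circuit M D \<and> D \<subseteq> C1 \<union> C2 \<and> x \<in> D \<and> z \<in> D"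
  using assms
proof (induction "card (C1 \<union> C2)" arbitrary: C1 C2 rule: less_induct)
  case less
  show ?case
  proof (rule ccontr)
    assume none: "\<not> ?case"
    let ?S = "sym_diff C1 C2"
    have g: "C1 \<subseteq> ground M" "C2 \<subseteq> ground M" and cyc: "cyc C1" "cyc C2"
      using less.prems circuit_iff_cyc by auto
    have fin: "finite (C1 \<union> C2)" using g finite_ground finite_subset by (metis finite_Un)
    have x: "x \<notin> C2" and z: "z \<notin> C1" using none less.prems by blast+
    have S: "cyc ?S" using cyc_sym_diff cyc g by blast
    obtain C3 where C3: "circuit M C3" "x \<in> C3" "C3 \<subseteq> ?S"
      using obtain_circuit_cyc[OF S, of x] g x less.prems by blast
    have z3: "z \<notin> C3" using none C3 by blast
    have "sym_diff ?S C3 = ?S - C3" using C3 by auto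
    then have "cyc (?S - C3)" using cyc_sym_diff[OF S, of C3] g C3 circuit_iff_cyc[of C3] by auto
    then obtain C4 where C4: "circuit M C4" "z \<in> C4" "C4 \<subseteq> ?S - C3"
      using obtain_circuit_cyc[of "?S - C3" z] g z z3 less.prems by blast
    have "\<not> C3 \<subseteq> C1"
    proof
      assume "C3 \<subseteq> C1"
      then have "C3 = C1" using C3 less.prems circuit_iff_cyc[of C1] circuit_iff_cyc[of C3] by blast
      then show False using C3 less.prems by blast
    qed
    \<comment> \<open>\<open>u\<close> witnesses the smaller union: it lies in \<open>C2\<close>,
      but neither in \<open>C1\<close> nor in \<open>C4\<close>, which avoids
      \<open>C3\<close>.\<close>
    then obtain u where u: "u \<in> C3" "u \<in> C2" "u \<notin> C1" using C3 by blast
    have "\<not> C4 \<subseteq> C2"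
    proof
      assume "C4 \<subseteq> C2"
      then have "C4 = C2" using C4 less.prems circuit_iff_cyc[of C2] circuit_iff_cyc[of C4] by blast
      then show False using C4 less.prems by blast
    qed
    then have "C1 \<inter> C4 \<noteq> {}" using C4 by blast
    moreover have "C1 \<union> C4 \<subset> C1 \<union> C2" using u C4 by blast
    then have "card (C1 \<union> C4) < card (C1 \<union> C2)" by (rule psubset_card_mono[OF fin])
    ultimately have "\<exists>D. circuit M D \<and> D \<subseteq> C1 \<union> C4 \<and> x \<in> D \<and> z \<in> D"
      using less.hyps[OF _ less.prems(1) C4(1) less.prems(3) C4(2)] by simp
    then show False using none \<open>C1 \<union> C4 \<subset> C1 \<union> C2\<close> by blast
  qed
qed

section \<open>Connected subsets and their enlargement by circuits\<close>

text \<open>Connectedness of \<open>M|S\<close> is phrased with circuits of \<open>M\<close>, so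
  that \<open>S\<close> can grow inside a fixed matroid. A single element of the ground set
  qualifies vacuously.\<close>

definition connected_set :: "'a set \<Rightarrow> bool" where
  "connected_set S \<longleftrightarrow>
     S \<subseteq> ground M \<and> (\<forall>x\<in>S. \<forall>y\<in>S. x \<noteq> y \<longrightarrow> (\<exists>C. (C \<subseteq> S \<and> circuit M C) \<and> x \<in> C \<and> y \<in> C))"

lemma connected_set_iff:
  "connected_set S \<longleftrightarrow> S \<subseteq> ground M \<and> connected_matroid (restriction M S)"
proof -
  have "ground (restriction M S) = S" by (simp add: restriction_def)
  then show ?thesis unfolding connected_set_def connected_matroid_def
    by (cases "S \<subseteq> ground M") (simp_all add: circuit_restriction)
qed

text \<open>An element of \<open>S\<close> other than the common element \<open>f\<close> shares a
  circuit inside \<open>S\<close> with \<open>f\<close>; that circuit meets \<open>C\<close> in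
  \<open>f\<close>, so \<open>circuit_trans\<close> links it to every element of
  \<open>C\<close>.\<close>

lemma connected_set_Un_circuit:
  assumes S: "connected_set S" and C: "circuit M C" and "S \<inter> C \<noteq> {}"
  shows "connected_set (S \<union> C)"
proof -
  obtain f where f: "f \<in> S" "f \<in> C" using assms by auto
  have mixed: "\<exists>D. circuit M D \<and> D \<subseteq> S \<union> C \<and> x \<in> D \<and> y \<in> D" if "x \<in> S" "y \<in> C" for x y
  proof (cases "x = f")
    case True
    then show ?thesis using that f C by blast
  next
    case False
    then obtain K where K: "circuit M K" "K \<subseteq> S" "x \<in> K" "f \<in> K"
      using S[unfolded connected_set_def] \<open>x \<in> S\<close> f by metis
    then have "\<exists>D. circuit M D \<and> D \<subseteq> K \<union> C \<and> x \<in> D \<and> y \<in> D"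
      using that f by (intro circuit_trans[OF K(1) C]) auto
    then show ?thesis using K by blast
  qed
  have "\<exists>D. circuit M D \<and> D \<subseteq> S \<union> C \<and> x \<in> D \<and> y \<in> D"
    if "x \<in> S \<union> C" "y \<in> S \<union> C" "x \<noteq> y" for x y
  proof -
    consider "x \<in> S" "y \<in> S" | "x \<in> S" "y \<in> C" | "x \<in> C" "y \<in> S" | "x \<in> C" "y \<in> C"
      using \<open>x \<in> S \<union> C\<close> \<open>y \<in> S \<union> C\<close> by blast
    then show ?thesis
    proof cases
      case 1
      then show ?thesis using S[unfolded connected_set_def] \<open>x \<noteq> y\<close> le_supI1 by metis
    next
      case 3
      then show ?thesis using mixed[of y x] by blast
    qed (use mixed C in blast)+
  qed
  then have "\<forall>x\<in>S \<union> C. \<forall>y\<in>S \<union> C. x \<noteq> y \<longrightarrow>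
      (\<exists>D. (D \<subseteq> S \<union> C \<and> circuit M D) \<and> x \<in> D \<and> y \<in> D)" by metis
  then show ?thesis using S circuit_subset_ground[OF C] unfolding connected_set_def by simp
qed

section \<open>Circuits with a smallest part outside \<open>F\<close>\<close>

text \<open>Otherwise some circuit inside \<open>Z\<close> leaves \<open>F\<close> in a nonempty
  proper subset of \<open>C - F\<close>. By minimality it misses \<open>F\<close>, so it lies
  properly inside the circuit \<open>C\<close>.\<close>

lemma cyc_ear:
  assumes C: "circuit M C" "C \<inter> F \<noteq> {}"
    and min: "\<And>D. circuit M D \<Longrightarrow> D \<inter> F \<noteq> {} \<Longrightarrow> \<not> D \<subseteq> F \<Longrightarrow> card (C - F) \<le> card (D - F)"
    and Z: "cyc Z" "Z \<subseteq> ground M" "Z - F \<subseteq> C - F" "Z - F \<noteq> {}"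
  shows "Z - F = C - F"
proof (rule ccontr)
  assume "Z - F \<noteq> C - F"
  obtain z where z: "z \<in> Z" "z \<notin> F" using Z by blast
  then obtain D where D: "circuit M D" "z \<in> D" "D \<subseteq> Z" using obtain_circuit_cyc Z by blast
  have fin: "finite C" using C(1) finite_circuit by simp
  have "D - F \<subset> C - F" using D Z \<open>Z - F \<noteq> C - F\<close> by blast
  then have "card (D - F) < card (C - F)" using fin by (intro psubset_card_mono) auto
  then have "D \<inter> F = {}" using min[OF D(1)] D z by force
  then have "D \<subset> C" using D Z C by blast
  then show False using D C circuit_def by metis
qed

lemma ear_spans:
  assumes "simple_matroid M" "connected_set F"
    and max: "\<And>S. connected_set S \<Longrightarrow> F \<subset> S \<Longrightarrow> rank M S = rank M (ground M)"
    and gap: "rank M F + 2 \<le> rank M (ground M)"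
    and C: "circuit M C" "C \<inter> F \<noteq> {}" "\<not> C \<subseteq> F"
    and min: "\<And>D. circuit M D \<Longrightarrow> D \<inter> F \<noteq> {} \<Longrightarrow> \<not> D \<subseteq> F \<Longrightarrow> card (C - F) \<le> card (D - F)"
  shows "3 \<le> card (C - F)" and "ground M = F \<union> C"
proof -
  have F: "F \<subseteq> ground M" using assms(2) unfolding connected_set_def by auto
  have Cg: "C \<subseteq> ground M" and Ccyc: "cyc C" using C circuit_iff_cyc by auto
  have finC: "finite C" using Cg finite_ground finite_subset by blast
  \<comment> \<open>Maximality of \<open>F\<close> makes \<open>F \<union> D\<close> spanning for
    every circuit \<open>D\<close> that meets and leaves \<open>F\<close>, which bounds
    \<open>card (D - F)\<close> from below.\<close>
  have big: "rank M (ground M) + 1 \<le> rank M F + card (D - F)"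
    and whole: "rank M (F \<union> D) = rank M (ground M)"
    if "circuit M D" "D \<inter> F \<noteq> {}" "\<not> D \<subseteq> F" for D
  proof -
    have "connected_set (F \<union> D)" using connected_set_Un_circuit assms(2) that by blast
    then show "rank M (F \<union> D) = rank M (ground M)" using that by (intro max) auto
    then show "rank M (ground M) + 1 \<le> rank M F + card (D - F)" using rank_Un_circuit[of D F] that by auto
  qed
  show card3: "3 \<le> card (C - F)" using big[OF C] gap by auto
  have rank_eq: "rank M (ground M) + 1 = rank M F + card (C - F)"
  proof (rule antisym)
    obtain c where c: "c \<in> C" "c \<notin> F" using C by blast
    obtain I where I: "I \<subseteq> F" "indep M I" "card I = rank M F" by (rule obtain_rank)
    \<comment> \<open>A basis of \<open>F\<close> together with all but one element of
      \<open>C - F\<close>. By \<open>cyc_ear\<close>, a cycle inside it that leaves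
      \<open>F\<close> would contain \<open>c\<close>, so the set is independent and gives the
      reverse bound on \<open>card (C - F)\<close>.\<close>
    let ?J = "I \<union> (C - F - {c})"
    have "Z = {}" if "Z \<subseteq> ?J" "cyc Z" for Z
    proof -
      have "Z - F = {}"
        using cyc_ear[OF C(1,2) min that(2)] that I c F Cg by blast
      then have "Z \<subseteq> I" using that by blast
      then show ?thesis using that I indep_iff_cyc[of I] F by blast
    qed
    then have "indep M ?J" using indep_iff_cyc[of ?J] I F Cg by blast
    then have "card ?J \<le> rank M (ground M)" using card_le_rank indep_subset_ground by blast
    moreover have "card ?J = card I + card (C - F - {c})"
      using I finite_indep finC by (intro card_Un_disjoint) auto
    moreover have "card (C - F) = Suc (card (C - F - {c}))" using card.remove[of "C - F" c] c finC by auto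
    ultimately show "rank M F + card (C - F) \<le> rank M (ground M) + 1" using I by auto
  qed (use big[OF C] in auto)
  show "ground M = F \<union> C"
  proof (rule ccontr)
    assume "ground M \<noteq> F \<union> C"
    then obtain z where z: "z \<in> ground M" "z \<notin> F" "z \<notin> C" using F Cg by blast
    have "rank M (insert z (F \<union> C)) \<le> rank M (ground M)" using z F Cg by (intro rank_mono) auto
    moreover have "rank M (F \<union> C) \<le> rank M (insert z (F \<union> C))" by (rule rank_mono) auto
    ultimately have "rank M (insert z (F \<union> C)) = rank M (F \<union> C)" using whole[OF C] by simp
    then obtain Z where Z: "circuit M Z" "z \<in> Z" "Z \<subseteq> insert z (F \<union> C)"
      using obtain_circuit_insert[of "F \<union> C" z] z F Cg by blast
    then have Zg: "Z \<subseteq> ground M" and Zcyc: "cyc Z" using circuit_iff_cyc by auto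
    let ?Y = "sym_diff Z C"
    have "cyc ?Y" using cyc_sym_diff Zcyc Ccyc Zg Cg by blast
    then obtain Y where Y: "circuit M Y" "z \<in> Y" "Y \<subseteq> ?Y"
      using obtain_circuit_cyc[of ?Y z] Zg Cg Z z by blast
    have no_short: "\<not> card (D - {z}) \<le> 1" if D: "circuit M D" "z \<in> D" for D
    proof
      assume le: "card (D - {z}) \<le> 1"
      have Dg: "D \<subseteq> ground M" using D unfolding circuit_def by auto
      then have "finite (D - {z})" using finite_ground finite_subset by blast
      then obtain y where "y \<in> ground M" "D \<subseteq> {z, y}"
        using le Dg z by (cases "D - {z} = {}") (auto simp: le_Suc_eq card_Suc_eq)
      then show False using simple_pair_indep[OF assms(1) z(1)] circuit_dependent[OF D(1)] by auto
    qed
    have disj: "(Z \<inter> C - F) \<inter> (Y \<inter> C - F) = {}" using Y by blast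
    have sum: "card (Z \<inter> C - F) + card (Y \<inter> C - F) \<le> card (C - F)"
      using card_Un_disjoint[OF _ _ disj] finC card_mono[of "C - F" "(Z \<inter> C - F) \<union> (Y \<inter> C - F)"] by auto
    \<comment> \<open>Besides \<open>z\<close>, a circuit that meets \<open>F\<close> needs all but
      at most one element of \<open>C - F\<close>, by \<open>big\<close> and
      \<open>rank_eq\<close>.\<close>
    have dich: "card (C - F) \<le> card (D \<inter> C - F) + 1"
      if D: "circuit M D" "z \<in> D" "D \<subseteq> insert z (F \<union> C)" "D \<inter> F \<noteq> {}" for D
    proof -
      have "D - F = insert z (D \<inter> C - F)" using D z by blast
      then have "card (D - F) = card (D \<inter> C - F) + 1" using z finC by auto
      moreover have "\<not> D \<subseteq> F" using D z by blast
      ultimately show ?thesis using big[OF D(1,4)] rank_eq by simp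
    qed
    have off: "D - {z} = D \<inter> C - F" if "D \<subseteq> insert z (F \<union> C)" "D \<inter> F = {}" for D
      using that z by blast
    have Yin: "Y \<subseteq> insert z (F \<union> C)" using Y Z by blast
    \<comment> \<open>With k = \<open>card (C - F)\<close>: if both meet \<open>F\<close>, then 2(k
      - 1) \<le> k, against k \<ge> 3. If only one does, the other has at most one element besides
      \<open>z\<close>, against \<open>no_short\<close>.\<close>
    have "Z \<inter> F = {} \<and> Y \<inter> F = {}"
      using dich[OF Z] dich[OF Y(1,2) Yin] off[OF Z(3)] off[OF Yin] no_short[OF Z(1,2)]
        no_short[OF Y(1,2)] sum card3
      by (cases "Z \<inter> F = {}"; cases "Y \<inter> F = {}") auto
    \<comment> \<open>The common element \<open>z\<close> cancels, and the inclusion is proper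
      because \<open>C\<close> meets \<open>F\<close>.\<close>
    then have sub: "sym_diff Z Y \<subset> C" using Z Y C Yin by blast
    have "Y \<subseteq> ground M" "cyc Y" using Y circuit_iff_cyc by auto
    then have "cyc (sym_diff Z Y)" using cyc_sym_diff Zcyc Zg by blast
    then have "Z = Y" using sub C(1) circuit_iff_cyc[of C] by blast
    \<comment> \<open>\<open>Y\<close> avoids \<open>Z \<inter> C\<close>, so \<open>Z = Y\<close>
      leaves nothing but \<open>z\<close>.\<close>
    then have "Z = {z}" using Y Z \<open>Z \<inter> F = {} \<and> Y \<inter> F = {}\<close> by blast
    then show False using no_short[OF Z(1,2)] by auto
  qed
qed

text \<open>If a basis avoided both \<open>x\<close> and \<open>y\<close>, the circuit created by
  adding \<open>x\<close> to it would leave \<open>F\<close>, hence contain all of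
  \<open>C - F\<close> by \<open>cyc_ear\<close>, including \<open>y\<close>.\<close>

lemma ear_series:
  assumes "connected_matroid M" "2 \<le> card (ground M)"
    and C: "circuit M C" "C \<inter> F \<noteq> {}"
    and min: "\<And>D. circuit M D \<Longrightarrow> D \<inter> F \<noteq> {} \<Longrightarrow> \<not> D \<subseteq> F \<Longrightarrow> card (C - F) \<le> card (D - F)"
    and E: "ground M = F \<union> C"
    and xy: "x \<in> C - F" "y \<in> C - F" "x \<noteq> y"
  shows "cocircuit M {x, y}"
proof -
  have "\<not> indep (dual M) {x, y}"
  proof
    assume "indep (dual M) {x, y}"
    then obtain B where B: "basis M B" "x \<notin> B" "y \<notin> B" unfolding dual_def by auto
    then have Bg: "B \<subseteq> ground M" and ind: "indep M B" using basis_iff indep_subset_ground by auto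
    have "\<not> indep M (insert x B)" using B unfolding basis_def by blast
    then obtain D where D: "circuit M D" "D \<subseteq> insert x B" using obtain_circuit[of "insert x B"] Bg xy E by blast
    have "x \<in> D" using D ind circuit_dependent[OF D(1), of B] by auto
    have "D - F = C - F"
    proof (rule cyc_ear[OF C min])
      show "cyc D" "D \<subseteq> ground M" using D circuit_iff_cyc by auto
    qed (use E D \<open>x \<in> D\<close> xy circuit_iff_cyc[of D] in blast)+
    then show False using D B xy by blast
  qed
  then show ?thesis using cocircuit_pair_iff assms E by blast
qed

end

section \<open>The cycle space of a matrix over the two-element field\<close>

text \<open>The terms over the intersection occur twice on the right and cancel in characteristic
  2.\<close>

lemma sum_bit_sym_diff:
  fixes f :: "'a \<Rightarrow> bit"
  assumes "finite X" "finite Y"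
  shows "sum f (sym_diff X Y) = sum f X + sum f Y"
proof -
  have "sum f (sym_diff X Y) = sum f (X - Y) + sum f (Y - X)"
    using assms by (intro sum.union_disjoint) auto
  moreover have "sum f X = sum f (X \<inter> Y) + sum f (X - Y)" using assms by (intro sum.Int_Diff)
  moreover have "sum f Y = sum f (X \<inter> Y) + sum f (Y - X)"
    using assms sum.Int_Diff[of Y f X] by (metis Int_commute)
  moreover have "(a + b) + (a + c) = b + c" for a b c :: bit
    by (cases a; cases b; cases c) auto
  ultimately show ?thesis by (simp only:)
qed

text \<open>Coefficients are 0 or 1, so a linear combination is the plain sum of the columns in its
  support.\<close>

lemma columns_independent_iff:
  assumes "finite X"
  shows "columns_independent m A X \<longleftrightarrow> (\<forall>Z\<subseteq>X. (\<forall>i<m. (\<Sum>x\<in>Z. A i x) = 0) \<longrightarrow> Z = {})"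
proof
  assume ind: "columns_independent m A X"
  show "\<forall>Z\<subseteq>X. (\<forall>i<m. (\<Sum>x\<in>Z. A i x) = 0) \<longrightarrow> Z = {}"
  proof (intro allI impI)
    fix Z assume Z: "Z \<subseteq> X" "\<forall>i<m. (\<Sum>x\<in>Z. A i x) = 0"
    let ?c = "\<lambda>x. if x \<in> Z then 1 else 0 :: bit"
    have "(\<Sum>x\<in>X. ?c x * A i x) = (\<Sum>x\<in>Z. A i x)" for i
      using assms Z(1) by (intro sum.mono_neutral_cong_right) auto
    then have "\<forall>x\<in>X. ?c x = 0"
      using ind[unfolded columns_independent_def, rule_format, of ?c] Z by auto
    then show "Z = {}" using Z(1) by (auto split: if_splits)
  qed
next
  assume R: "\<forall>Z\<subseteq>X. (\<forall>i<m. (\<Sum>x\<in>Z. A i x) = 0) \<longrightarrow> Z = {}"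
  show "columns_independent m A X" unfolding columns_independent_def
  proof (intro allI impI)
    fix c :: "'a \<Rightarrow> bit" assume c: "\<forall>i<m. (\<Sum>x\<in>X. c x * A i x) = 0"
    let ?Z = "{x \<in> X. c x \<noteq> 0}"
    have "(\<Sum>x\<in>X. c x * A i x) = (\<Sum>x\<in>?Z. A i x)" for i
      using assms by (intro sum.mono_neutral_cong_right) auto
    then have "\<forall>i<m. (\<Sum>x\<in>?Z. A i x) = 0" using c by simp
    then have "?Z = {}" using R[rule_format, of ?Z] by simp
    then show "\<forall>x\<in>X. c x = 0" by auto
  qed
qed

lemma binary_matroid_cycles:
  assumes "matroid M" "binary_matroid M"
  obtains cyc where "binary_cycles M cyc"
proof -
  interpret finite_matroid M using assms by unfold_locales
  obtain m A where A: "\<forall>X. X \<subseteq> ground M \<longrightarrow> (indep M X \<longleftrightarrow> columns_independent m A X)"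
    using assms unfolding binary_matroid_def by blast
  let ?cyc = "\<lambda>Z. \<forall>i<m. (\<Sum>x\<in>Z. A i x) = 0"
  have fin: "finite X" if "X \<subseteq> ground M" for X using that finite_ground finite_subset by blast
  have "binary_cycles M ?cyc"
  proof
    fix X Y assume "?cyc X" "?cyc Y" "X \<subseteq> ground M" "Y \<subseteq> ground M"
    then show "?cyc (sym_diff X Y)" using sum_bit_sym_diff[of X Y] fin by simp
  next
    fix X assume "X \<subseteq> ground M"
    then show "indep M X \<longleftrightarrow> (\<forall>Z\<subseteq>X. ?cyc Z \<longrightarrow> Z = {})"
      using A fin columns_independent_iff by metis
  qed
  then show ?thesis using that by blast
qed

section \<open>Choice of \<open>F\<close> and the three outcomes\<close>

theorem theorem3p3:
  fixes M :: "'a indep_system" and e :: 'a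
  assumes "matroid M"
    and "simple_matroid M"
    and "connected_matroid M"
    and "binary_matroid M"
    and "e \<in> ground M"
    and "2 \<le> card (ground M)"
  shows "circuit M (ground M) \<or>
         (\<exists>H. hyperplane M H \<and> e \<in> H \<and> connected_matroid (restriction M H)) \<or>
         (\<exists>S. series_class M S \<and> 3 \<le> card S \<and> e \<notin> S)"
proof -
  obtain cyc where "binary_cycles M cyc" using binary_matroid_cycles assms by blast
  then interpret binary_cycles M cyc .
  let ?P = "\<lambda>S. connected_set S \<and> e \<in> S \<and> rank M S < rank M (ground M)"
  have "\<not> ground M \<subseteq> {e}" using assms(6) card_mono[of "{e}" "ground M"] by auto
  then obtain y where y: "y \<in> ground M" "y \<noteq> e" by auto
  \<comment> \<open>\<open>{e}\<close> is a first candidate: simplicity gives \<open>M\<close> rank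
    at least 2, while \<open>{e}\<close> has rank at most 1.\<close>
  have "card {e, y} \<le> rank M (ground M)"
    using simple_pair_indep[OF assms(2)] y assms(5) by (intro card_le_rank) auto
  moreover have "rank M ({} \<union> {e}) \<le> rank M {} + card ({e} - {})" by (rule rank_Un_le) auto
  moreover have "rank M {} = 0" using obtain_rank[of "{}"] by (metis card.empty subset_empty)
  ultimately have "?P {e}" using y assms(5) unfolding connected_set_def by auto
  moreover have "finite {S. ?P S}"
    by (rule finite_subset[of _ "Pow (ground M)"]) (auto simp: finite_ground connected_set_def)
  ultimately obtain F where F: "?P F" and Fmax: "\<And>S. ?P S \<Longrightarrow> F \<subseteq> S \<Longrightarrow> S = F"
    using finite_has_maximal[of "{S. ?P S}"] by (metis (mono_tags, lifting) empty_iff mem_Collect_eq)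
  have Fg: "F \<subseteq> ground M" using F unfolding connected_set_def by auto
  have max: "rank M S = rank M (ground M)" if "connected_set S" "F \<subset> S" for S
    using Fmax[of S] that F rank_mono[of S "ground M"] unfolding connected_set_def by force
  show ?thesis
  proof (cases "rank M F + 1 = rank M (ground M)")
    case True
    \<comment> \<open>\<open>F\<close> is a flat: a circuit through \<open>x\<close> in
      \<open>insert x F\<close> is no loop, so it meets \<open>F\<close> and makes
      \<open>insert x F\<close> a larger connected set of the same rank.\<close>
    have "x \<in> F" if x: "x \<in> ground M" "rank M (insert x F) = rank M F" for x
    proof (rule ccontr)
      assume nx: "x \<notin> F"
      then obtain C where C: "circuit M C" "x \<in> C" "C \<subseteq> insert x F"
        using obtain_circuit_insert Fg x by blast
      have "C \<noteq> {x}" using C assms(2) x unfolding simple_matroid_def loop_def by auto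
      then have "F \<inter> C \<noteq> {}" using C by blast
      then have "connected_set (F \<union> C)" using connected_set_Un_circuit F C by blast
      moreover have "F \<union> C = insert x F" using C by blast
      ultimately show False using max[of "insert x F"] nx x F by auto
    qed
    then have "matroid_closure M F = F" using Fg unfolding matroid_closure_def by (auto simp: insert_absorb)
    then have "hyperplane M F" using True Fg unfolding hyperplane_def flat_def by auto
    then show ?thesis using F connected_set_iff by blast
  next
    case False
    then have gap: "rank M F + 2 \<le> rank M (ground M)" using F by auto
    let ?Q = "\<lambda>C. circuit M C \<and> C \<inter> F \<noteq> {} \<and> \<not> C \<subseteq> F"
    have "F \<noteq> ground M" using F by auto
    then obtain w where w: "w \<in> ground M" "w \<notin> F" using Fg by blast
    then have "\<exists>C. circuit M C \<and> e \<in> C \<and> w \<in> C"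
      using assms(3,5) F unfolding connected_matroid_def by metis
    then have "\<exists>C. ?Q C" using w F by blast
    then obtain C where C: "?Q C" and Cmin: "\<And>D. ?Q D \<Longrightarrow> card (C - F) \<le> card (D - F)"
      using ex_has_least_nat[of ?Q _ "\<lambda>C. card (C - F)"] by blast
    have card3: "3 \<le> card (C - F)" and E: "ground M = F \<union> C"
      using ear_spans[of F C] assms(2) F max gap C Cmin by blast+
    show ?thesis
    proof (cases "F = {e}")
      case True
      then have "ground M = C" using C E by auto
      then show ?thesis using C by auto
    next
      case False
      then obtain f where "f \<in> F" "f \<noteq> e" using F by blast
      \<comment> \<open>A circuit through \<open>e\<close> inside \<open>F\<close> misses
        \<open>x\<close>, which will keep \<open>e\<close> out of the series class of
        \<open>x\<close>.\<close>
      then obtain K where K: "circuit M K" "K \<subseteq> F" "e \<in> K"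
        using F unfolding connected_set_def by blast
      obtain x where x: "x \<in> C" "x \<notin> F" using C by blast
      let ?S = "series_relation M `` {x}"
      note nc = not_coloop[OF assms(3,6)]
      have "series_class M ?S" using x E nc unfolding series_class_def by (intro quotientI) auto
      \<comment> \<open>The class of \<open>x\<close> inherits its size from
        \<open>C - F\<close>.\<close>
      moreover have "C - F \<subseteq> ?S"
      proof
        fix y assume y: "y \<in> C - F"
        have "x = y \<or> cocircuit M {x, y}"
          using ear_series[OF assms(3,6), of C F x y] C Cmin E x y by blast
        then show "y \<in> ?S" using x y E nc unfolding series_relation_def by auto
      qed
      moreover have "finite ?S"
        by (rule finite_subset[OF _ finite_ground]) (auto simp: series_relation_def)
      ultimately have "series_class M ?S" "3 \<le> card ?S"
        using card3 card_mono[of ?S "C - F"] by auto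
      moreover have "e \<notin> ?S"
        using not_cocircuit_pair[OF assms(3,6) K(1,3), of x] K x E F unfolding series_relation_def by auto
      ultimately show ?thesis by blast
    qed
  qed
qed

end
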